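(* For every constant integer $q\ge4$, any CONGEST algorithm (possibly randomized, succeeding with probability at least $2/3$) that detects whether a directed unweighted $n$-vertex graph contains a directed cycle of length exactly $q$ requires $\Omega\!\left(\frac{n}{\log n}\right)$ rounds in the worst case.
   Context: CONGEST model: the communication network is the graph $G=(V,E)$, $n=|V|$; each node has a unique identifier in $\{0,\dots,n-1\}$, knows its own and its neighbours' identifiers and its incident edges (with their directions); computation proceeds in synchronous rounds in which each node may send a message of $O(\log n)$ bits to each neighbour; local computation is free; communication links are bidirectional even when $G$ is directed. $q$-cycle detection: some vertex must report a cycle if $G$ contains a simple directed cycle of length $q$, and no vertex may report one otherwise. *)

theory Defs
  imports "HOL-Probability.Probability"
begin

definition digraph :: "nat \<Rightarrow> (nat \<times> nat) set \<Rightarrow> bool" where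
  "digraph n E \<longleftrightarrow> E \<subseteq> {..<n} \<times> {..<n} \<and> (\<forall>v. (v, v) \<notin> E)"

definition out_nbrs :: "(nat \<times> nat) set \<Rightarrow> nat \<Rightarrow> nat set" where
  "out_nbrs E v = {w. (v, w) \<in> E}"

definition in_nbrs :: "(nat \<times> nat) set \<Rightarrow> nat \<Rightarrow> nat set" where
  "in_nbrs E v = {u. (u, v) \<in> E}"

text \<open>Communication links are bidirectional.\<close>
definition nbrs :: "(nat \<times> nat) set \<Rightarrow> nat \<Rightarrow> nat set" where
  "nbrs E v = out_nbrs E v \<union> in_nbrs E v"

definition has_dcycle :: "(nat \<times> nat) set \<Rightarrow> nat \<Rightarrow> bool" where
  "has_dcycle E q \<longleftrightarrow> (\<exists>vs. length vs = q \<and> distinct vs \<and>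
       (\<forall>i<q. (vs ! i, vs ! ((i + 1) mod q)) \<in> E))"

text \<open>A (randomized) CONGEST algorithm with seed type 's and local state type 'st.
  Each node v draws a private random seed from coin v, independently.
  The initial state depends on the node's identifier, its out- and in-neighbours and
  its seed. In each round every node sends (send state w) to each neighbour w, then
  updates its state from the received messages (indexed by sender id; non-neighbours
  deliver the empty message). report says whether the node reports a q-cycle.\<close>
record ('s, 'st) congest_alg =
  coin :: "nat \<Rightarrow> 's pmf"
  init :: "nat \<Rightarrow> nat set \<Rightarrow> nat set \<Rightarrow> 's \<Rightarrow> 'st"
  send :: "'st \<Rightarrow> nat \<Rightarrow> bool list"
  recv :: "'st \<Rightarrow> (nat \<Rightarrow> bool list) \<Rightarrow> 'st"
  report :: "'st \<Rightarrow> bool"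

fun states :: "('s, 'st) congest_alg \<Rightarrow> (nat \<times> nat) set \<Rightarrow> (nat \<Rightarrow> 's) \<Rightarrow> nat \<Rightarrow> nat \<Rightarrow> 'st" where
  "states A E \<rho> 0 v = init A v (out_nbrs E v) (in_nbrs E v) (\<rho> v)"
| "states A E \<rho> (Suc t) v =
     recv A (states A E \<rho> t v)
       (\<lambda>u. if u \<in> nbrs E v then send A (states A E \<rho> t u) v else [])"

definition solves_cycle_detection ::
  "nat \<Rightarrow> nat \<Rightarrow> nat \<Rightarrow> nat \<Rightarrow> ('s, 'st) congest_alg \<Rightarrow> bool" where
  "solves_cycle_detection q n B T A \<longleftrightarrow>
     (\<forall>s w. length (send A s w) \<le> B) \<and>
     (\<forall>E. digraph n E \<longrightarrow>
        measure_pmf.prob (Pi_pmf {..<n} undefined (coin A))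
          {\<rho>. (\<exists>v<n. report A (states A E \<rho> T v)) \<longleftrightarrow> has_dcycle E q} \<ge> 2 / 3)"

end

theory Submission
  imports Defs
begin

text \<open>
  Set disjointness on the universe of pairs (i, j) with i, j < m is embedded into a layered
  graph with q layers of m vertices: Alice's set X gives the edges from layer 0 to layer 1, Bob's set Y
  the edges from layer q - 2 to layer q - 1, and all other layers are joined cyclically by fixed matchings.
  Every directed q-cycle goes round once and closes up only through a pair in X and in Y.
  The cut between layers 0, 1 and the rest has 2m links, so T rounds with B-bit messages
  partition the inputs into at most 2 powr (4mT(B + 1)) rectangles.

  The linear lower bound for disjointness is a corruption bound in the style of Razborov. Each coordinate
  is owned by Alice or by Bob (S is Alice's part), and X, Y are uniform subsets of S and of its complement. If a
  rectangle is not exponentially small, an exponential moment bound shows that, given membership in the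
  rectangle, all but few coordinates remain nearly unbiased. Putting a random coordinate into both sets
  therefore loses only a constant factor, so a rectangle on which no cycle is reported contains
  intersecting pairs in proportion. The constants are chosen so that error 1/3 already gives a
  contradiction, without amplification.
\<close>

subsection \<open>Coordinate bias of dense set families\<close>

definition down_sum :: "('a set \<Rightarrow> real) \<Rightarrow> 'a set \<Rightarrow> real" where
  "down_sum f S = (\<Sum>X\<in>Pow S. f X)"

lemma down_sum_insert:
  assumes "finite S" "i \<notin> S"
  shows "down_sum f (insert i S) = down_sum f S + down_sum (\<lambda>X. f (insert i X)) S"
proof -
  have "inj_on (insert i) (Pow S)"
    using assms by (intro inj_on_inverseI[where g = "\<lambda>X. X - {i}"]) auto
  moreover have "Pow S \<inter> insert i ` Pow S = {}"
    using assms by blast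
  ultimately show ?thesis
    using assms by (simp add: down_sum_def Pow_insert sum.union_disjoint sum.reindex)
qed

lemma down_sum_nonneg: "(\<And>X. 0 \<le> f X) \<Longrightarrow> 0 \<le> down_sum f S"
  by (simp add: down_sum_def sum_nonneg)

lemma down_sum_le:
  assumes "finite S" "\<And>X. f X \<le> 1"
  shows "down_sum f S \<le> 2 ^ card S"
proof -
  have "down_sum f S \<le> (\<Sum>X\<in>Pow S. 1)"
    unfolding down_sum_def by (intro sum_mono assms)
  then show ?thesis using assms by (simp add: card_Pow)
qed

text \<open>Each element of \<open>S\<close> joins \<open>X\<close> or not, independently of the
  others, so the sum is a product with a factor \<open>1 + a\<close> for every element of
  \<open>I\<close> and 2 for every other one.\<close>

lemma sum_Pow_power_card_Int:
  fixes a :: real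
  assumes "finite S" "I \<subseteq> S"
  shows "(\<Sum>X\<in>Pow S. a ^ card (X \<inter> I)) = 2 ^ card (S - I) * (1 + a) ^ card I"
proof -
  let ?h = "\<lambda>i. if i \<in> I then a else 1"
  have "(\<Prod>i\<in>X. ?h i) = a ^ card (X \<inter> I)" if "X \<in> Pow S" for X
    using that assms finite_subset[of X S] by (simp add: prod.If_cases Int_def)
  then have "(\<Sum>X\<in>Pow S. a ^ card (X \<inter> I)) = (\<Sum>X\<in>Pow S. prod ?h X * prod (\<lambda>_. 1) (S - X))"
    by simp
  also have "\<dots> = (\<Prod>i\<in>S. ?h i + 1)"
    by (rule prod_add[OF assms(1), symmetric])
  also have "\<dots> = (\<Prod>i\<in>S. if i \<in> I then a + 1 else 2)"
    by (intro prod.cong) auto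
  also have "\<dots> = (a + 1) ^ card I * 2 ^ card (S - I)"
    using assms by (simp add: prod.If_cases Int_absorb1 Diff_eq)
  finally show ?thesis by (simp add: add.commute mult.commute)
qed

text \<open>The value of (1 + a) / 2 * a powr (- 9 / 20) at a = 4 / 5, the base in the exponential moment bound.\<close>

definition bias_rate :: real where
  "bias_rate = 9 / 10 * (5 / 4) powr (9 / 20)"

text \<open>The twentieth power clears the fractional exponent and leaves rational arithmetic:
  \<open>(9 / 10) ^ 20 * (5 / 4) ^ 9\<close> is about 0.906.\<close>

lemma bias_rate: "0 < bias_rate" "bias_rate < 1"
proof -
  show "0 < bias_rate" by (simp add: bias_rate_def)
  have "bias_rate ^ 20 = (9 / 10) ^ 20 * ((5 / 4) powr (9 / 20)) ^ 20"
    unfolding bias_rate_def by (rule power_mult_distrib)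
  also have "((5 / 4 :: real) powr (9 / 20)) ^ 20 = (5 / 4) ^ 9"
    by (simp add: powr_power powr_numeral)
  also have "(9 / 10) ^ 20 * (5 / 4) ^ 9 < (1 :: real) ^ 20"
    by (simp add: power_divide)
  finally show "bias_rate < 1"
    by (rule power_less_imp_less_base) simp
qed

text \<open>A Chernoff argument. Under the weights \<open>f\<close> the mean of
  \<open>card (X \<inter> I)\<close> is at most \<open>9 / 20 * card I\<close>, below the uniform
  mean \<open>card I / 2\<close>. By convexity this bounds the exponential moment from below, while
  \<open>f \<le> 1\<close> bounds it from above by the unweighted one.\<close>

lemma down_sum_le_biased:
  assumes fin: "finite S" and sub: "I \<subseteq> S" and f: "\<And>X. 0 \<le> f X" "\<And>X. f X \<le> 1"
    and bias: "\<And>i. i \<in> I \<Longrightarrow> (\<Sum>X\<in>{X\<in>Pow S. i \<in> X}. f X) \<le> 9 / 20 * down_sum f S"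
  shows "down_sum f S \<le> 2 ^ card S * bias_rate ^ card I"
proof -
  define F where "F = down_sum f S"
  \<comment> \<open>The tilt \<open>exp (- \<theta>) = 4 / 5\<close> is a convenient rational near 9
    / 11, where \<open>(1 + a) / 2 * a powr (- 9 / 20)\<close> is smallest.\<close>
  define \<theta> :: real where "\<theta> = ln (5 / 4)"
  define \<mu> where "\<mu> = 9 / 20 * real (card I)"
  have finI: "finite I" using fin sub finite_subset by blast
  have \<theta>: "\<theta> > 0" by (simp add: \<theta>_def)
  have pw: "(4 / 5 :: real) ^ k = exp (- \<theta> * k)" for k :: nat
  proof -
    have "exp (- \<theta> * k) = exp (- \<theta>) ^ k"
      by (metis exp_of_nat_mult mult.commute)
    then show ?thesis by (simp add: \<theta>_def exp_minus)
  qed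
  have "(\<Sum>X\<in>Pow S. f X * card (X \<inter> I)) = (\<Sum>X\<in>Pow S. \<Sum>i\<in>I. if i \<in> X then f X else 0)"
  proof (intro sum.cong refl)
    fix X assume "X \<in> Pow S"
    have "(\<Sum>i\<in>I. if i \<in> X then f X else 0) = (\<Sum>i\<in>I \<inter> X. f X)"
      by (rule sum.inter_restrict[symmetric, OF finI])
    then show "f X * card (X \<inter> I) = (\<Sum>i\<in>I. if i \<in> X then f X else 0)"
      by (simp add: Int_commute mult.commute)
  qed
  also have "\<dots> = (\<Sum>i\<in>I. \<Sum>X\<in>Pow S. if i \<in> X then f X else 0)"
    by (rule sum.swap)
  also have "\<dots> = (\<Sum>i\<in>I. \<Sum>X\<in>{X\<in>Pow S. i \<in> X}. f X)"
    using fin by (intro sum.cong refl sum.inter_filter[symmetric]) simp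
  also have "\<dots> \<le> (\<Sum>i\<in>I. 9 / 20 * F)"
    unfolding F_def by (intro sum_mono bias)
  finally have mean: "(\<Sum>X\<in>Pow S. f X * card (X \<inter> I)) \<le> \<mu> * F"
    by (simp add: \<mu>_def algebra_simps)
  \<comment> \<open>The added term is nonnegative by \<open>mean\<close>; it turns the right side
    into a weighted sum of values of the tangent line to \<open>exp (- \<theta> * x)\<close> at
    \<open>\<mu>\<close>.\<close>
  have "exp (- \<theta> * \<mu>) * F \<le> exp (- \<theta> * \<mu>) * (F + \<theta> * (\<mu> * F - (\<Sum>X\<in>Pow S. f X * card (X \<inter> I))))"
    using mean \<theta> by simp
  also have "\<dots> = (\<Sum>X\<in>Pow S. f X * (exp (- \<theta> * \<mu>) * (1 - \<theta> * (card (X \<inter> I) - \<mu>))))"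
    unfolding F_def down_sum_def
    by (simp add: algebra_simps sum.distrib sum_subtractf sum_distrib_left sum_distrib_right)
  also have "\<dots> \<le> (\<Sum>X\<in>Pow S. (4 / 5) ^ card (X \<inter> I))"
  proof (intro sum_mono)
    fix X
    have "exp (- \<theta> * \<mu>) * (1 - \<theta> * (card (X \<inter> I) - \<mu>))
        \<le> exp (- \<theta> * \<mu>) * exp (- \<theta> * (card (X \<inter> I) - \<mu>))"
      using exp_ge_add_one_self[of "- \<theta> * (card (X \<inter> I) - \<mu>)"]
      by (intro mult_left_mono) auto
    also have "\<dots> = exp (- \<theta> * card (X \<inter> I))"
      by (simp add: exp_add[symmetric] algebra_simps)
    finally have *: "exp (- \<theta> * \<mu>) * (1 - \<theta> * (card (X \<inter> I) - \<mu>)) \<le> (4 / 5) ^ card (X \<inter> I)"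
      by (simp add: pw)
    have "f X * (exp (- \<theta> * \<mu>) * (1 - \<theta> * (card (X \<inter> I) - \<mu>))) \<le> f X * (4 / 5) ^ card (X \<inter> I)"
      by (intro mult_left_mono * f)
    also have "\<dots> \<le> 1 * (4 / 5) ^ card (X \<inter> I)"
      by (intro mult_right_mono f) simp
    finally show "f X * (exp (- \<theta> * \<mu>) * (1 - \<theta> * (card (X \<inter> I) - \<mu>))) \<le> (4 / 5) ^ card (X \<inter> I)"
      by simp
  qed
  also have "\<dots> = 2 ^ card (S - I) * (9 / 5) ^ card I"
    using sum_Pow_power_card_Int[OF fin sub, of "4 / 5"] by simp
  also have "\<dots> = 2 ^ card S * (9 / 10) ^ card I"
  proof -
    have "card S = card (S - I) + card I"
      using fin sub finI by (metis add.commute card_mono card_Diff_subset le_add_diff_inverse)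
    then show ?thesis
      by (simp add: power_add flip: power_mult_distrib)
  qed
  finally have "F \<le> exp (\<theta> * \<mu>) * (2 ^ card S * (9 / 10) ^ card I)"
    by (simp add: exp_minus field_simps)
  also have "exp (\<theta> * \<mu>) = ((5 / 4) powr (9 / 20)) ^ card I"
  proof -
    have "exp (\<theta> * \<mu>) = exp (real (card I) * (9 / 20 * \<theta>))"
      by (simp add: \<mu>_def algebra_simps)
    also have "\<dots> = exp (9 / 20 * \<theta>) ^ card I"
      by (rule exp_of_nat_mult)
    finally show ?thesis by (simp add: \<theta>_def powr_def)
  qed
  finally show ?thesis
    unfolding F_def bias_rate_def power_mult_distrib by (simp add: mult_ac)
qed

text \<open>The two sums are the parts of \<open>down_sum f S\<close> with \<open>i\<close> absent
  and with \<open>i\<close> present. For nonnegative \<open>f\<close> the strict inequalities leave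
  no coordinate biased when the total vanishes.\<close>

definition biased_coords :: "('a set \<Rightarrow> real) \<Rightarrow> 'a set \<Rightarrow> 'a set" where
  "biased_coords f S = {i\<in>S. down_sum f (S - {i}) < 9 / 20 * down_sum f S \<or>
     down_sum (\<lambda>X. f (insert i X)) (S - {i}) < 9 / 20 * down_sum f S}"

text \<open>Read contrapositively: a dense family has few biased coordinates. At least half of the
  biased coordinates lean the same way. Presence being too rare is the case of
  \<open>down_sum_le_biased\<close>; absence being too rare reduces to it by complementing every set
  within \<open>S\<close>.\<close>

lemma few_biased_coords:
  assumes fin: "finite S" and f: "\<And>X. 0 \<le> f X" "\<And>X. f X \<le> 1"
    and many: "real (card (biased_coords f S)) > d"
  shows "down_sum f S \<le> 2 ^ card S * bias_rate powr (d / 2)"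
proof -
  define I0 where "I0 = {i\<in>S. down_sum f (S - {i}) < 9 / 20 * down_sum f S}"
  define I1 where "I1 = {i\<in>S. down_sum (\<lambda>X. f (insert i X)) (S - {i}) < 9 / 20 * down_sum f S}"
  have "card (biased_coords f S) \<le> card I0 + card I1"
  proof -
    have "biased_coords f S = I0 \<union> I1"
      by (auto simp: biased_coords_def I0_def I1_def)
    then show ?thesis using card_Un_le[of I0 I1] by simp
  qed
  moreover have 0: "down_sum f S \<le> 2 ^ card S * bias_rate ^ card I0"
  proof -
    let ?f = "\<lambda>X. f (S - X)"
    have bij: "(\<Sum>X\<in>{X\<in>Pow S. P (S - X)}. ?f X) = (\<Sum>X\<in>{X\<in>Pow S. P X}. f X)" for P
      by (rule sum.reindex_bij_witness[of _ "\<lambda>X. S - X" "\<lambda>X. S - X"]) (auto simp: double_diff)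
    have eq: "down_sum ?f S = down_sum f S"
      using bij[of "\<lambda>_. True"] by (simp add: down_sum_def Pow_def)
    have "down_sum ?f S \<le> 2 ^ card S * bias_rate ^ card I0"
    proof (rule down_sum_le_biased[OF fin])
      show "I0 \<subseteq> S" by (auto simp: I0_def)
      fix i assume i: "i \<in> I0"
      have "(\<Sum>X\<in>{X\<in>Pow S. i \<in> X}. ?f X) = (\<Sum>X\<in>{X\<in>Pow S. i \<notin> S - X}. ?f X)"
        using i by (intro sum.cong) (auto simp: I0_def)
      also have "\<dots> = down_sum f (S - {i})"
        unfolding bij[of "\<lambda>X. i \<notin> X"] down_sum_def by (intro sum.cong) auto
      finally show "(\<Sum>X\<in>{X\<in>Pow S. i \<in> X}. ?f X) \<le> 9 / 20 * down_sum ?f S"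
        using i eq by (simp add: I0_def)
    qed (use f in auto)
    with eq show ?thesis by simp
  qed
  moreover have 1: "down_sum f S \<le> 2 ^ card S * bias_rate ^ card I1"
  proof (rule down_sum_le_biased[OF fin _ f])
    show "I1 \<subseteq> S" by (auto simp: I1_def)
    fix i assume i: "i \<in> I1"
    have "(\<Sum>X\<in>{X\<in>Pow S. i \<in> X}. f X) = down_sum (\<lambda>X. f (insert i X)) (S - {i})"
      unfolding down_sum_def
      by (rule sum.reindex_bij_witness[of _ "insert i" "\<lambda>X. X - {i}"])
         (use i in \<open>auto simp: I1_def insert_absorb\<close>)
    then show "(\<Sum>X\<in>{X\<in>Pow S. i \<in> X}. f X) \<le> 9 / 20 * down_sum f S"
      using i by (simp add: I1_def)
  qed
  ultimately obtain k where k: "real k \<ge> d / 2" "down_sum f S \<le> 2 ^ card S * bias_rate ^ k"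
    using many by (cases "real (card I0) \<ge> d / 2") force+
  have "bias_rate ^ k \<le> bias_rate powr (d / 2)"
    using bias_rate k(1) by (simp add: powr_realpow[symmetric] powr_mono')
  then have "2 ^ card S * bias_rate ^ k \<le> 2 ^ card S * bias_rate powr (d / 2)"
    by (intro mult_left_mono) auto
  with k(2) show ?thesis by linarith
qed

subsection \<open>Corruption bound for set disjointness\<close>

text \<open>Unnormalised: each triple (S, X, Y) has weight 1, for a total of 4 ^ card V in the disjoint case and
  card V * 4 ^ (card V - 1) in the intersecting case.\<close>

definition disj_mass :: "'a set \<Rightarrow> ('a set \<Rightarrow> 'a set \<Rightarrow> real) \<Rightarrow> real" where
  "disj_mass V h = (\<Sum>S\<in>Pow V. \<Sum>X\<in>Pow S. \<Sum>Y\<in>Pow (V - S). h X Y)"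

definition inter_mass :: "'a set \<Rightarrow> ('a set \<Rightarrow> 'a set \<Rightarrow> real) \<Rightarrow> real" where
  "inter_mass V h = (\<Sum>i\<in>V. \<Sum>S\<in>Pow (V - {i}). \<Sum>X\<in>Pow S. \<Sum>Y\<in>Pow (V - {i} - S).
     h (insert i X) (insert i Y))"

lemma disj_mass_rectangle:
  "disj_mass V (\<lambda>X Y. f X * g Y) = (\<Sum>S\<in>Pow V. down_sum f S * down_sum g (V - S))"
  by (simp add: disj_mass_def down_sum_def sum_product)

lemma inter_mass_rectangle:
  "inter_mass V (\<lambda>X Y. f X * g Y) = (\<Sum>i\<in>V. \<Sum>S\<in>Pow (V - {i}).
     down_sum (\<lambda>X. f (insert i X)) S * down_sum (\<lambda>Y. g (insert i Y)) (V - {i} - S))"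
  by (simp add: inter_mass_def down_sum_def sum_product)

lemma sum_Pow_split:
  fixes h :: "'a set \<Rightarrow> real"
  assumes "finite V" "i \<in> V"
  shows "(\<Sum>S\<in>Pow V. h S) = (\<Sum>S\<in>Pow (V - {i}). h (insert i S)) + (\<Sum>S\<in>Pow (V - {i}). h S)"
  using down_sum_insert[of "V - {i}" i h] assms by (simp add: down_sum_def insert_absorb)

text \<open>Reindexed by \<open>insert i S\<close>, the sum counts the biased coordinates of each
  set. Either at most 1 / 100 of \<open>V\<close> is biased, which accounts for the first term, or
  \<open>few_biased_coords\<close> with \<open>d = card V / 100\<close> makes the product of the two
  sums at most \<open>bias_rate powr (card V / 200) * 2 ^ card V\<close>; the
  \<open>2 ^ card V\<close> choices of the set then give the power of 4.\<close>

lemma biased_mass_le: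
  fixes V :: "'a set"
  assumes fin: "finite V"
    and f: "\<And>X. 0 \<le> f X" "\<And>X. f X \<le> 1" and g: "\<And>X. 0 \<le> g X" "\<And>X. g X \<le> 1"
  shows "(\<Sum>i\<in>V. \<Sum>S\<in>Pow (V - {i}). of_bool (i \<in> biased_coords f (insert i S)) *
             (down_sum f (insert i S) * down_sum g (V - {i} - S)))
       \<le> card V * ((\<Sum>S\<in>Pow V. down_sum f S * down_sum g (V - S)) / 100
                   + bias_rate powr (card V / 200) * 4 ^ card V)" (is "?L \<le> _")
proof -
  define r where "r = bias_rate powr (card V / 200)"
  have r: "r \<ge> 0" by (simp add: r_def)
  let ?t = "\<lambda>i S. of_bool (i \<in> biased_coords f S) * (down_sum f S * down_sum g (V - S))"
  have "?L = (\<Sum>i\<in>V. \<Sum>S\<in>Pow V. ?t i S)"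
  proof (rule sum.cong[OF refl])
    fix i assume i: "i \<in> V"
    have z: "(\<Sum>S\<in>Pow (V - {i}). ?t i S) = 0"
      by (intro sum.neutral) (auto simp: biased_coords_def)
    have "V - {i} - S = V - insert i S" for S by auto
    then show "(\<Sum>S\<in>Pow (V - {i}). of_bool (i \<in> biased_coords f (insert i S)) *
             (down_sum f (insert i S) * down_sum g (V - {i} - S))) = (\<Sum>S\<in>Pow V. ?t i S)"
      unfolding sum_Pow_split[OF fin i] z by simp
  qed
  also have "\<dots> = (\<Sum>S\<in>Pow V. \<Sum>i\<in>V. ?t i S)"
    by (rule sum.swap)
  also have "\<dots> = (\<Sum>S\<in>Pow V. card (biased_coords f S) * (down_sum f S * down_sum g (V - S)))"
  proof (intro sum.cong refl)
    fix S assume "S \<in> Pow V"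
    then have "V \<inter> {i. i \<in> biased_coords f S} = biased_coords f S"
      by (auto simp: biased_coords_def)
    then show "(\<Sum>i\<in>V. ?t i S) = card (biased_coords f S) * (down_sum f S * down_sum g (V - S))"
      using fin by (simp add: sum_distrib_right[symmetric] sum_of_bool_eq)
  qed
  also have "\<dots> \<le> (\<Sum>S\<in>Pow V. card V * (down_sum f S * down_sum g (V - S) / 100 + r * 2 ^ card V))"
  proof (intro sum_mono)
    fix S assume S: "S \<in> Pow V"
    then have finS: "finite S" using fin finite_subset by blast
    have F0: "0 \<le> down_sum f S" "0 \<le> down_sum g (V - S)"
      using f g by (auto intro: down_sum_nonneg)
    show "card (biased_coords f S) * (down_sum f S * down_sum g (V - S))
        \<le> card V * (down_sum f S * down_sum g (V - S) / 100 + r * 2 ^ card V)"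
    proof (cases "real (card (biased_coords f S)) \<le> card V / 100")
      case True
      then have "card (biased_coords f S) * (down_sum f S * down_sum g (V - S))
          \<le> card V / 100 * (down_sum f S * down_sum g (V - S))"
        using F0 by (intro mult_right_mono) auto
      also have "\<dots> \<le> card V * (down_sum f S * down_sum g (V - S) / 100 + r * 2 ^ card V)"
        using r by (simp add: algebra_simps)
      finally show ?thesis .
    next
      case False
      then have "down_sum f S \<le> 2 ^ card S * bias_rate powr (card V / 100 / 2)"
        by (intro few_biased_coords finS f) auto
      then have "down_sum f S * down_sum g (V - S) \<le> (2 ^ card S * r) * 2 ^ card (V - S)"
        using F0 r fin g by (intro mult_mono down_sum_le) (auto simp: r_def)
      also have "\<dots> = r * 2 ^ card V"
        using S fin finS
        by (simp add: card_Diff_subset card_mono flip: power_add)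
      finally have *: "down_sum f S * down_sum g (V - S) \<le> r * 2 ^ card V" .
      have "card (biased_coords f S) \<le> card V"
        using S fin by (intro card_mono) (auto simp: biased_coords_def)
      then have "card (biased_coords f S) * (down_sum f S * down_sum g (V - S)) \<le> card V * (r * 2 ^ card V)"
        using * F0 r by (intro mult_mono[where d = "r * 2 ^ card V"] mult_nonneg_nonneg) auto
      also have "\<dots> \<le> card V * (down_sum f S * down_sum g (V - S) / 100 + r * 2 ^ card V)"
        using F0 by (intro mult_left_mono) auto
      finally show ?thesis .
    qed
  qed
  also have "\<dots> = card V * ((\<Sum>S\<in>Pow V. down_sum f S * down_sum g (V - S)) / 100 + r * 4 ^ card V)"
  proof -
    have "(4 :: real) ^ card V = 2 ^ card V * 2 ^ card V"
      by (simp flip: power_mult_distrib)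
    then show ?thesis
      using fin by (simp add: sum_distrib_left[symmetric] sum.distrib sum_divide_distrib[symmetric] card_Pow)
  qed
  finally show ?thesis by (simp add: r_def)
qed

text \<open>The two sums stand for owning the coordinate by Alice and by Bob; the flags mark the bias of either side.
  One-sided bias can be charged to the biased owner, since the other factor is then balanced.\<close>

lemma unbiased_product_le:
  fixes a a1 c c1 :: real
  assumes nn: "0 \<le> a" "0 \<le> a1" "0 \<le> c" "0 \<le> c1"
    and A: "\<not> bA \<Longrightarrow> a \<ge> 9 / 20 * (a + a1) \<and> a1 \<ge> 9 / 20 * (a + a1)"
    and C: "\<not> bC \<Longrightarrow> c \<ge> 9 / 20 * (c + c1) \<and> c1 \<ge> 9 / 20 * (c + c1)"
  shows "81 / 220 * ((a + a1) * c + a * (c + c1)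
           - 4 * (of_bool bA * ((a + a1) * c) + of_bool bC * (a * (c + c1)))) \<le> 2 * (a1 * c1)"
proof -
  define P Q R S where "P = a * c" and "Q = a1 * c" and "R = a * c1" and "S = a1 * c1"
  have m: "0 \<le> P" "0 \<le> Q" "0 \<le> R" "0 \<le> S"
    using nn by (auto simp: P_def Q_def R_def S_def)
  have A': "9 * Q \<le> 11 * P \<and> 9 * S \<le> 11 * R \<and> 9 * P \<le> 11 * Q" if "\<not> bA"
  proof -
    have "9 * a1 \<le> 11 * a" "9 * a \<le> 11 * a1" using A[OF that] by auto
    then have "(9 * a1) * c \<le> (11 * a) * c" "(9 * a1) * c1 \<le> (11 * a) * c1" "(9 * a) * c \<le> (11 * a1) * c"
      using nn by (auto intro: mult_right_mono)
    then show ?thesis by (simp add: P_def Q_def R_def S_def)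
  qed
  have C': "9 * R \<le> 11 * P \<and> 9 * Q \<le> 11 * S \<and> 9 * P \<le> 11 * R" if "\<not> bC"
  proof -
    have "9 * c1 \<le> 11 * c" "9 * c \<le> 11 * c1" using C[OF that] by auto
    then have "a * (9 * c1) \<le> a * (11 * c)" "a1 * (9 * c) \<le> a1 * (11 * c1)" "a * (9 * c) \<le> a * (11 * c1)"
      using nn by (auto intro: mult_left_mono)
    then show ?thesis by (simp add: P_def Q_def R_def S_def)
  qed
  have D': "9 * R \<le> 11 * S" if "\<not> bA"
  proof -
    have "9 * a \<le> 11 * a1" using A[OF that] by auto
    then have "(9 * a) * c1 \<le> (11 * a1) * c1" by (intro mult_right_mono nn)
    then show ?thesis by (simp add: R_def S_def)
  qed
  have e: "(a + a1) * c = P + Q" "a * (c + c1) = P + R"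
    by (simp_all add: P_def Q_def R_def algebra_simps)
  \<comment> \<open>Without bias on either side, \<open>P \<le> 121 / 81 * S\<close> and
    \<open>Q\<close>, \<open>R\<close> are at most \<open>11 / 9 * S\<close>, so
    \<open>2 * P + Q + R \<le> 440 / 81 * S\<close>; this fixes the constant 81 / 220. In every
    other case the weight 4 makes the bracket nonpositive.\<close>
  have "81 / 220 * (P + Q + (P + R) - 4 * (of_bool bA * (P + Q) + of_bool bC * (P + R))) \<le> 2 * S"
  proof (cases bA)
    case True
    then show ?thesis using m C' by (cases bC) auto
  next
    case False
    then show ?thesis using m A' C' D' by (cases bC) auto
  qed
  then show ?thesis
    unfolding e S_def[symmetric] by simp
qed

text \<open>The disjoint mass is split, once for every coordinate, by the owner of that coordinate.
  \<open>unbiased_product_le\<close> converts the unbiased part into intersecting mass and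
  \<open>biased_mass_le\<close> bounds the rest. For \<open>f\<close> and \<open>g\<close>
  constantly 1 the ratio would be 1 / 4; the smaller 3 / 20 pays for the bias.\<close>

lemma rectangle_corruption:
  fixes V :: "'a set"
  assumes fin: "finite V"
    and f: "\<And>X. 0 \<le> f X" "\<And>X. f X \<le> 1" and g: "\<And>X. 0 \<le> g X" "\<And>X. g X \<le> 1"
  shows "card V * (3 / 20 * disj_mass V (\<lambda>X Y. f X * g Y)
            - 3 / 2 * bias_rate powr (card V / 200) * 4 ^ card V)
         \<le> inter_mass V (\<lambda>X Y. f X * g Y)"
proof -
  define r where "r = bias_rate powr (card V / 200) * 4 ^ card V"
  have r: "r \<ge> 0" by (simp add: r_def)
  let ?F = "down_sum f" and ?G = "down_sum g"
  let ?F1 = "\<lambda>i. down_sum (\<lambda>X. f (insert i X))" and ?G1 = "\<lambda>i. down_sum (\<lambda>X. g (insert i X))"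
  define D where "D = disj_mass V (\<lambda>X Y. f X * g Y)"
  have D: "D = (\<Sum>S\<in>Pow V. ?F S * ?G (V - S))"
    by (simp add: D_def disj_mass_rectangle)
  have D0: "D \<ge> 0"
    unfolding D by (intro sum_nonneg mult_nonneg_nonneg down_sum_nonneg f g)
  have refl_sum: "(\<Sum>S\<in>Pow W. h S (W - S)) = (\<Sum>S\<in>Pow W. h (W - S) S)"
    for h :: "'a set \<Rightarrow> 'a set \<Rightarrow> real" and W
    by (rule sum.reindex_bij_witness[of _ "\<lambda>X. W - X" "\<lambda>X. W - X"]) (auto simp: double_diff)
  define KA where "KA = (\<Sum>i\<in>V. \<Sum>S\<in>Pow (V - {i}). of_bool (i \<in> biased_coords f (insert i S)) *
             (?F (insert i S) * ?G (V - {i} - S)))"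
  define KB where "KB = (\<Sum>i\<in>V. \<Sum>S\<in>Pow (V - {i}). of_bool (i \<in> biased_coords g (insert i (V - {i} - S))) *
             (?F S * ?G (insert i (V - {i} - S))))"
  have KA: "KA \<le> card V * (D / 100 + r)"
    using biased_mass_le[OF fin f g] by (simp add: KA_def D r_def)
  \<comment> \<open>Exchanging the players, that is \<open>S\<close> with its complement and
    \<open>f\<close> with \<open>g\<close>, reduces Bob's case to Alice's.\<close>
  have KB: "KB \<le> card V * (D / 100 + r)"
  proof -
    have "KB = (\<Sum>i\<in>V. \<Sum>S\<in>Pow (V - {i}). of_bool (i \<in> biased_coords g (insert i S)) *
             (?G (insert i S) * ?F (V - {i} - S)))"
      unfolding KB_def
      by (intro sum.cong refl
          trans[OF refl_sum[where h = "\<lambda>S S'. of_bool (_ \<in> biased_coords g (insert _ S')) * (?F S * ?G (insert _ S'))"]])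
         (simp add: mult.commute)
    moreover have "D = (\<Sum>S\<in>Pow V. ?G S * ?F (V - S))"
      unfolding D by (subst refl_sum[where h = "\<lambda>S S'. ?F S * ?G S'"]) (simp add: mult.commute)
    ultimately show ?thesis
      using biased_mass_le[OF fin g f] by (simp add: r_def)
  qed
  \<comment> \<open>For fixed \<open>i\<close>, a member of \<open>Pow V\<close> either contains
    \<open>i\<close> (Alice owns it) or does not (Bob owns it), so the two terms exhaust
    \<open>D\<close>.\<close>
  have split: "(\<Sum>S\<in>Pow (V - {i}). ?F (insert i S) * ?G (V - {i} - S) + ?F S * ?G (insert i (V - {i} - S))) = D"
    if i: "i \<in> V" for i
  proof -
    have "V - {i} - S = V - insert i S" for S by auto
    moreover have "insert i (V - insert i S) = V - S" if "S \<in> Pow (V - {i})" for S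
      using that i by auto
    then have "(\<Sum>S\<in>Pow (V - {i}). ?F S * ?G (insert i (V - insert i S))) = (\<Sum>S\<in>Pow (V - {i}). ?F S * ?G (V - S))"
      by (intro sum.cong) auto
    ultimately show ?thesis
      unfolding D sum_Pow_split[OF fin i] by (simp add: sum.distrib)
  qed
  have "81 / 220 * (card V * D - 4 * (KA + KB)) =
     (\<Sum>i\<in>V. \<Sum>S\<in>Pow (V - {i}). 81 / 220 *
       (?F (insert i S) * ?G (V - {i} - S) + ?F S * ?G (insert i (V - {i} - S))
        - 4 * (of_bool (i \<in> biased_coords f (insert i S)) * (?F (insert i S) * ?G (V - {i} - S))
             + of_bool (i \<in> biased_coords g (insert i (V - {i} - S))) * (?F S * ?G (insert i (V - {i} - S))))))"
    (is "_ = ?R")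
  proof -
    have "?R = 81 / 220 * ((\<Sum>i\<in>V. \<Sum>S\<in>Pow (V - {i}). ?F (insert i S) * ?G (V - {i} - S) + ?F S * ?G (insert i (V - {i} - S)))
        - 4 * (KA + KB))"
      unfolding KA_def KB_def
      by (simp only: sum_distrib_left[symmetric] sum_subtractf sum.distrib)
    also have "(\<Sum>i\<in>V. \<Sum>S\<in>Pow (V - {i}). ?F (insert i S) * ?G (V - {i} - S) + ?F S * ?G (insert i (V - {i} - S))) = card V * D"
      using split by (simp cong: sum.cong)
    finally show ?thesis by simp
  qed
  also have "\<dots> \<le> (\<Sum>i\<in>V. \<Sum>S\<in>Pow (V - {i}). 2 * (?F1 i S * ?G1 i (V - {i} - S)))"
  proof (intro sum_mono)
    fix i S assume i: "i \<in> V" and S: "S \<in> Pow (V - {i})"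
    define S' where "S' = V - {i} - S"
    have fS: "finite S" "finite S'" "i \<notin> S" "i \<notin> S'"
      using fin S finite_subset[of S V] by (auto simp: S'_def)
    have eF: "?F (insert i S) = ?F S + ?F1 i S" and eG: "?G (insert i S') = ?G S' + ?G1 i S'"
      using fS by (simp_all add: down_sum_insert)
    have bA: "\<not> i \<in> biased_coords f (insert i S) \<Longrightarrow>
        ?F S \<ge> 9 / 20 * (?F S + ?F1 i S) \<and> ?F1 i S \<ge> 9 / 20 * (?F S + ?F1 i S)"
      using fS by (auto simp: biased_coords_def eF)
    have bB: "\<not> i \<in> biased_coords g (insert i S') \<Longrightarrow>
        ?G S' \<ge> 9 / 20 * (?G S' + ?G1 i S') \<and> ?G1 i S' \<ge> 9 / 20 * (?G S' + ?G1 i S')"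
      using fS by (auto simp: biased_coords_def eG)
    show "81 / 220 *
       (?F (insert i S) * ?G (V - {i} - S) + ?F S * ?G (insert i (V - {i} - S))
        - 4 * (of_bool (i \<in> biased_coords f (insert i S)) * (?F (insert i S) * ?G (V - {i} - S))
             + of_bool (i \<in> biased_coords g (insert i (V - {i} - S))) * (?F S * ?G (insert i (V - {i} - S)))))
        \<le> 2 * (?F1 i S * ?G1 i (V - {i} - S))"
      unfolding S'_def[symmetric] eF eG
      by (rule unbiased_product_le) (use bA bB in \<open>auto intro!: down_sum_nonneg f g\<close>)
  qed
  also have "\<dots> = 2 * inter_mass V (\<lambda>X Y. f X * g Y)"
    by (simp add: inter_mass_rectangle sum_distrib_left)
  finally have "81 / 220 * (card V * D - 4 * (KA + KB)) \<le> 2 * inter_mass V (\<lambda>X Y. f X * g Y)" .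
  moreover have "KA \<le> card V * D / 100 + card V * r" "KB \<le> card V * D / 100 + card V * r"
    using KA KB by (simp_all add: algebra_simps)
  moreover have "0 \<le> card V * D" "0 \<le> card V * r"
    using D0 r by auto
  \<comment> \<open>Rounding: \<open>81 / 220 * (1 - 8 / 100) / 2\<close> exceeds 3 / 20 and
    \<open>81 / 220 * 8 / 2\<close> is below 3 / 2.\<close>
  moreover have "3 / 20 * P - 3 / 2 * Q \<le> J"
    if "81 / 220 * (P - 4 * (a + b)) \<le> 2 * J" "a \<le> P / 100 + Q" "b \<le> P / 100 + Q" "0 \<le> P" "0 \<le> Q"
    for P Q J a b :: real
    using that by (simp add: field_simps)
  ultimately have "3 / 20 * (card V * D) - 3 / 2 * (card V * r) \<le> inter_mass V (\<lambda>X Y. f X * g Y)"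
    by blast
  then show ?thesis by (simp add: D_def r_def algebra_simps)
qed

section \<open>From one rectangle to a whole protocol\<close>

lemma disj_mass_sum: "disj_mass V (\<lambda>X Y. \<Sum>k\<in>K. h k X Y) = (\<Sum>k\<in>K. disj_mass V (h k))"
  unfolding disj_mass_def by (simp only: sum.swap[of _ K])

lemma inter_mass_sum: "inter_mass V (\<lambda>X Y. \<Sum>k\<in>K. h k X Y) = (\<Sum>k\<in>K. inter_mass V (h k))"
  unfolding inter_mass_def by (simp only: sum.swap[of _ K])

lemma card_Diff_Pow: "finite V \<Longrightarrow> S \<in> Pow V \<Longrightarrow> (2::real) ^ card S * 2 ^ card (V - S) = 2 ^ card V"
  by (metis Pow_iff card_Diff_subset card_mono finite_subset le_add_diff_inverse power_add)

lemma disj_mass_const: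
  assumes "finite V"
  shows "disj_mass V (\<lambda>_ _. a) = a * 4 ^ card V"
proof -
  have "disj_mass V (\<lambda>_ _. a) = (\<Sum>S\<in>Pow V. 2 ^ card V * a)"
    unfolding disj_mass_def
  proof (intro sum.cong refl)
    fix S assume S: "S \<in> Pow V"
    then have "finite S" using assms finite_subset by blast
    then show "(\<Sum>X\<in>Pow S. \<Sum>Y\<in>Pow (V - S). a) = 2 ^ card V * a"
      using assms card_Diff_Pow[OF assms S] by (simp add: card_Pow)
  qed
  also have "\<dots> = a * 4 ^ card V"
    using assms by (simp add: card_Pow flip: power_mult_distrib mult.assoc)
  finally show ?thesis .
qed

lemma inter_mass_const:
  assumes "finite V"
  shows "inter_mass V (\<lambda>_ _. a) = a * card V * 4 ^ card V / 4"
proof -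
  have "inter_mass V (\<lambda>_ _. a) = (\<Sum>i\<in>V. disj_mass (V - {i}) (\<lambda>_ _. a))"
    by (simp add: inter_mass_def disj_mass_def)
  also have "\<dots> = (\<Sum>i\<in>V. a * 4 ^ card V / 4)"
  proof (intro sum.cong refl)
    fix i assume "i \<in> V"
    then have "card V = Suc (card (V - {i}))"
      using assms by (metis card.remove)
    then show "disj_mass (V - {i}) (\<lambda>_ _. a) = a * 4 ^ card V / 4"
      using assms by (simp add: disj_mass_const)
  qed
  finally show ?thesis by simp
qed

lemma disj_mass_mono:
  "(\<And>X Y. X \<subseteq> V \<Longrightarrow> Y \<subseteq> V \<Longrightarrow> X \<inter> Y = {} \<Longrightarrow> h X Y \<le> h' X Y) \<Longrightarrow> disj_mass V h \<le> disj_mass V h'"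
  unfolding disj_mass_def
proof (intro sum_mono)
  fix S X Y
  assume h: "\<And>X Y. X \<subseteq> V \<Longrightarrow> Y \<subseteq> V \<Longrightarrow> X \<inter> Y = {} \<Longrightarrow> h X Y \<le> h' X Y"
    and "S \<in> Pow V" "X \<in> Pow S" "Y \<in> Pow (V - S)"
  then show "h X Y \<le> h' X Y" by (intro h) auto
qed

lemma inter_mass_mono:
  "(\<And>X Y. X \<subseteq> V \<Longrightarrow> Y \<subseteq> V \<Longrightarrow> X \<inter> Y \<noteq> {} \<Longrightarrow> h X Y \<le> h' X Y) \<Longrightarrow> inter_mass V h \<le> inter_mass V h'"
  unfolding inter_mass_def
proof (intro sum_mono)
  fix i S X Y
  assume h: "\<And>X Y. X \<subseteq> V \<Longrightarrow> Y \<subseteq> V \<Longrightarrow> X \<inter> Y \<noteq> {} \<Longrightarrow> h X Y \<le> h' X Y"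
    and "i \<in> V" "S \<in> Pow (V - {i})" "X \<in> Pow S" "Y \<in> Pow (V - {i} - S)"
  then show "h (insert i X) (insert i Y) \<le> h' (insert i X) (insert i Y)" by (intro h) auto
qed

text \<open>By \<open>paste\<close>, the pairs with \<open>P\<close> and a given value of
  \<open>\<tau>\<close> form a rectangle whose sides are the projections \<open>f k\<close> and
  \<open>g k\<close>. Summing \<open>rectangle_corruption\<close> over \<open>K\<close> costs the
  additive error once per value.\<close>

lemma protocol_corruption:
  fixes V :: "'a set" and \<tau> :: "'a set \<Rightarrow> 'a set \<Rightarrow> 'k"
  assumes fin: "finite V" "finite K" and K: "\<And>X Y. \<tau> X Y \<in> K"
    and paste: "\<And>X Y X' Y'. P X Y \<Longrightarrow> P X' Y' \<Longrightarrow> \<tau> X Y = \<tau> X' Y' \<Longrightarrow> P X Y' \<and> \<tau> X Y' = \<tau> X Y"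
  shows "card V * (3 / 20 * disj_mass V (\<lambda>X Y. of_bool (P X Y))
            - 3 / 2 * card K * bias_rate powr (card V / 200) * 4 ^ card V)
         \<le> inter_mass V (\<lambda>X Y. of_bool (P X Y))"
proof -
  define r where "r = bias_rate powr (card V / 200) * 4 ^ card V"
  define f :: "'k \<Rightarrow> 'a set \<Rightarrow> real" where "f = (\<lambda>k X. of_bool (\<exists>Y. P X Y \<and> \<tau> X Y = k))"
  define g :: "'k \<Rightarrow> 'a set \<Rightarrow> real" where "g = (\<lambda>k Y. of_bool (\<exists>X. P X Y \<and> \<tau> X Y = k))"
  have fg: "f k X * g k Y = of_bool (P X Y \<and> \<tau> X Y = k)" for k X Y
  proof -
    have "P X Y \<and> \<tau> X Y = k" if "P X Y'" "\<tau> X Y' = k" "P X' Y" "\<tau> X' Y = k" for X' Y'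
      using paste[OF that(1,3)] that by simp
    then have "(\<exists>Y. P X Y \<and> \<tau> X Y = k) \<and> (\<exists>X. P X Y \<and> \<tau> X Y = k) \<longleftrightarrow> P X Y \<and> \<tau> X Y = k"
      by blast
    then show ?thesis
      by (simp add: f_def g_def flip: of_bool_conj)
  qed
  have "(of_bool (P X Y) :: real) = (\<Sum>k\<in>K. of_bool (P X Y \<and> \<tau> X Y = k))" for X Y
    using fin K by (simp add: of_bool_conj sum_distrib_left[symmetric] of_bool_def)
  then have h: "(of_bool (P X Y) :: real) = (\<Sum>k\<in>K. f k X * g k Y)" for X Y
    by (simp add: fg)
  have "card V * (3 / 20 * disj_mass V (\<lambda>X Y. of_bool (P X Y)) - 3 / 2 * card K * r)
      = (\<Sum>k\<in>K. card V * (3 / 20 * disj_mass V (\<lambda>X Y. f k X * g k Y) - 3 / 2 * r))"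
    unfolding h disj_mass_sum
    by (simp only: sum_distrib_left[symmetric] sum_subtractf) (simp add: algebra_simps)
  also have "\<dots> \<le> (\<Sum>k\<in>K. inter_mass V (\<lambda>X Y. f k X * g k Y))"
    using rectangle_corruption[OF fin(1), of "f _" "g _"]
    by (intro sum_mono) (simp add: f_def g_def r_def mult.assoc)
  also have "\<dots> = inter_mass V (\<lambda>X Y. of_bool (P X Y))"
    unfolding h inter_mass_sum ..
  finally show ?thesis by (simp add: r_def mult.assoc)
qed

subsection \<open>The layered graph\<close>

text \<open>Vertex v lies in layer v div m and column v mod m.\<close>

definition cyc_graph :: "nat \<Rightarrow> nat \<Rightarrow> (nat \<times> nat) set \<Rightarrow> (nat \<times> nat) set \<Rightarrow> (nat \<times> nat) set" where
  "cyc_graph q m X Y = {(u, v). u < q * m \<and> v < q * m \<and> v div m = (u div m + 1) mod q \<and>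
     (if u div m = 0 then (u mod m, v mod m) \<in> X
      else if u div m = q - 2 then (v mod m, u mod m) \<in> Y
      else v mod m = u mod m)}"

lemma digraph_cyc_graph:
  assumes "2 \<le> q" "q * m \<le> n"
  shows "digraph n (cyc_graph q m X Y)"
proof -
  have "(v, v) \<notin> cyc_graph q m X Y" for v
  proof
    assume "(v, v) \<in> cyc_graph q m X Y"
    then have "v < q * m" "v div m = (v div m + 1) mod q"
      by (auto simp: cyc_graph_def)
    moreover from this have "v div m < q"
      by (simp add: less_mult_imp_div_less)
    ultimately show False
      using assms(1) by (cases "v div m + 1 = q") auto
  qed
  then show ?thesis
    using assms by (auto simp: digraph_def cyc_graph_def)
qed

text \<open>A q-cycle meets the layers in cyclic order. The matchings keep the column from layer 1
  to layer q - 2 and from layer q - 1 to layer 0, so the edges governed by \<open>X\<close> and by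
  \<open>Y\<close> carry the same pair; for this the pair in \<open>Y\<close> is read against the
  edge direction.\<close>

lemma cyc_graph_dcycle_imp_inter:
  assumes q: "4 \<le> q" and cyc: "has_dcycle (cyc_graph q m X Y) q"
  shows "X \<inter> Y \<noteq> {}"
proof -
  let ?E = "cyc_graph q m X Y"
  obtain vs where vs: "\<And>i. i < q \<Longrightarrow> (vs ! i, vs ! ((i + 1) mod q)) \<in> ?E"
    using cyc by (auto simp: has_dcycle_def)
  \<comment> \<open>Rotation by \<open>s\<close> puts \<open>w k\<close> in layer
    \<open>k\<close>.\<close>
  define s where "s = q - vs ! 0 div m"
  define w where "w k = vs ! ((s + k) mod q)" for k
  have edge: "(w k, w (Suc k)) \<in> ?E" for k
    using vs[of "(s + k) mod q"] q by (simp add: w_def mod_Suc_eq)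
  have "(vs ! 0, vs ! (1 mod q)) \<in> ?E"
    using vs[of 0] q by simp
  then have l0: "vs ! 0 div m < q"
    by (auto simp: cyc_graph_def less_mult_imp_div_less)
  have layer: "i < q \<Longrightarrow> vs ! i div m = (vs ! 0 div m + i) mod q" for i
  proof (induction i)
    case 0
    then show ?case using l0 by simp
  next
    case (Suc i)
    then have "vs ! Suc i div m = (vs ! i div m + 1) mod q"
      using vs[of i] by (auto simp: cyc_graph_def)
    with Suc show ?case by (simp add: mod_Suc_eq)
  qed
  have wl: "k < q \<Longrightarrow> w k div m = k" for k
  proof -
    assume k: "k < q"
    have "w k div m = (vs ! 0 div m + (s + k)) mod q"
      using q layer[of "(s + k) mod q"] by (simp add: w_def mod_add_right_eq)
    also have "vs ! 0 div m + (s + k) = k + q"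
      using l0 by (simp add: s_def)
    finally show ?thesis using k by simp
  qed
  have mid: "k < q - 2 \<Longrightarrow> w (Suc k) mod m = w 1 mod m" for k
  proof (induction k)
    case (Suc k)
    have "w (Suc (Suc k)) mod m = w (Suc k) mod m"
      using edge[of "Suc k"] wl[of "Suc k"] Suc.prems by (auto simp: cyc_graph_def)
    with Suc show ?case by simp
  qed simp
  have wq: "w q = w 0"
    by (simp add: w_def)
  have "(w 0 mod m, w 1 mod m) \<in> X"
    using edge[of 0] wl[of 0] q by (auto simp: cyc_graph_def)
  moreover have "(w (q - 1) mod m, w (q - 2) mod m) \<in> Y"
  proof -
    have "Suc (q - 2) = q - 1" using q by simp
    then show ?thesis
      using edge[of "q - 2"] wl[of "q - 2"] q by (auto simp: cyc_graph_def)
  qed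
  moreover have "w (q - 2) mod m = w 1 mod m"
  proof -
    have "Suc (q - 3) = q - 2" using q by simp
    then show ?thesis using mid[of "q - 3"] q by simp
  qed
  moreover have "w (q - 1) mod m = w 0 mod m"
  proof -
    have "Suc (q - 1) = q" "q - 1 \<noteq> q - 2" using q by auto
    then show ?thesis
      using edge[of "q - 1"] wl[of "q - 1"] wq q by (auto simp: cyc_graph_def)
  qed
  ultimately show ?thesis by auto
qed

lemma cyc_graph_inter_imp_dcycle:
  assumes q: "4 \<le> q" and ij: "(i, j) \<in> X" "(i, j) \<in> Y" "i < m" "j < m"
  shows "has_dcycle (cyc_graph q m X Y) q"
proof -
  \<comment> \<open>Column \<open>i\<close> in layers q - 1 and 0, column \<open>j\<close> in
    between: the column can change only on the edges governed by \<open>X\<close> and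
    \<open>Y\<close>.\<close>
  define c where "c k = (if k = 0 \<or> k = q - 1 then i else j)" for k
  define f where "f k = k * m + c k" for k
  have c: "c k < m" for k using ij by (simp add: c_def)
  have f: "f k div m = k" "f k mod m = c k" for k
    using c[of k] by (simp_all add: f_def)
  have f_less: "f k < q * m" if "k < q" for k
  proof -
    have "f k < Suc k * m" using c[of k] by (simp add: f_def)
    also have "\<dots> \<le> q * m" using that by (intro mult_right_mono) auto
    finally show ?thesis .
  qed
  have "distinct (map f [0..<q])"
    by (auto simp: distinct_map intro!: inj_on_inverseI[where g = "\<lambda>v. v div m"] f)
  moreover have "(f k, f (Suc k mod q)) \<in> cyc_graph q m X Y" if k: "k < q" for k
  proof -
    have "Suc k mod q < q" using q by simp
    moreover have "Suc k mod q = (if k = q - 1 then 0 else Suc k)"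
      using k by auto
    ultimately show ?thesis
      using k q ij f_less[OF k] f_less[of "Suc k mod q"]
      by (auto simp: cyc_graph_def f c_def)
  qed
  ultimately show ?thesis
    unfolding has_dcycle_def by (intro exI[of _ "map f [0..<q]"]) (use q in auto)
qed

lemma has_dcycle_cyc_graph_iff:
  assumes "4 \<le> q" "X \<subseteq> {..<m} \<times> {..<m}"
  shows "has_dcycle (cyc_graph q m X Y) q \<longleftrightarrow> X \<inter> Y \<noteq> {}"
  using assms cyc_graph_dcycle_imp_inter cyc_graph_inter_imp_dcycle by blast

text \<open>\<open>Y\<close> governs only edges from layer q - 2 to layer q - 1, and for
  \<open>q \<ge> 4\<close> both lie outside layers 0 and 1. So Alice knows all edges at her
  vertices; \<open>cyc_graph_local_high\<close> is the counterpart for Bob.\<close>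

lemma cyc_graph_local_low:
  assumes q: "4 \<le> q" and v: "v < 2 * m"
  shows "out_nbrs (cyc_graph q m X Y) v = out_nbrs (cyc_graph q m X Y') v"
    and "in_nbrs (cyc_graph q m X Y) v = in_nbrs (cyc_graph q m X Y') v"
proof -
  have "v div m < 2" using v by (simp add: less_mult_imp_div_less)
  then show "out_nbrs (cyc_graph q m X Y) v = out_nbrs (cyc_graph q m X Y') v"
    using q by (auto simp: out_nbrs_def cyc_graph_def)
  have "(u, v) \<in> cyc_graph q m X Y \<longleftrightarrow> (u, v) \<in> cyc_graph q m X Y'" for u
  proof (cases "v div m = (u div m + 1) mod q")
    case True
    have "u div m \<noteq> q - 2"
    proof
      assume "u div m = q - 2"
      then have "u div m + 1 = q - 1" using q by simp
      with True q \<open>v div m < 2\<close> show False by simp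
    qed
    then show ?thesis by (simp add: cyc_graph_def)
  qed (simp add: cyc_graph_def)
  then show "in_nbrs (cyc_graph q m X Y) v = in_nbrs (cyc_graph q m X Y') v"
    by (simp add: in_nbrs_def)
qed

lemma cyc_graph_local_high:
  assumes q: "4 \<le> q" and m: "0 < m" and v: "2 * m \<le> v"
  shows "out_nbrs (cyc_graph q m X Y) v = out_nbrs (cyc_graph q m X' Y) v"
    and "in_nbrs (cyc_graph q m X Y) v = in_nbrs (cyc_graph q m X' Y) v"
proof -
  have l: "2 \<le> v div m" using m v by (simp add: less_eq_div_iff_mult_less_eq)
  then show "out_nbrs (cyc_graph q m X Y) v = out_nbrs (cyc_graph q m X' Y) v"
    by (auto simp: out_nbrs_def cyc_graph_def)
  have "(u, v) \<in> cyc_graph q m X Y \<longleftrightarrow> (u, v) \<in> cyc_graph q m X' Y" for u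
  proof (cases "v div m = (u div m + 1) mod q")
    case True
    then have "u div m \<noteq> 0" using q l by (intro notI) simp
    then show ?thesis by (simp add: cyc_graph_def)
  qed (simp add: cyc_graph_def)
  then show "in_nbrs (cyc_graph q m X Y) v = in_nbrs (cyc_graph q m X' Y) v"
    by (simp add: in_nbrs_def)
qed

text \<open>Messages travel both ways, so each link of the matchings between layers 1 and 2 and
  between layers q - 1 and 0 appears in both orders. The set is the same for all \<open>X\<close>
  and \<open>Y\<close>.\<close>

definition cut_pairs :: "nat \<Rightarrow> nat \<Rightarrow> (nat \<times> nat) set" where
  "cut_pairs q m = (\<Union>j<m. {(m + j, 2 * m + j), (2 * m + j, m + j), ((q - 1) * m + j, j), (j, (q - 1) * m + j)})"

lemma finite_cut_pairs: "finite (cut_pairs q m)"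
  by (simp add: cut_pairs_def)

lemma card_cut_pairs: "card (cut_pairs q m) \<le> 4 * m"
proof -
  have "card (cut_pairs q m) \<le> (\<Sum>j<m. card {(m + j, 2 * m + j), (2 * m + j, m + j), ((q - 1) * m + j, j), (j, (q - 1) * m + j)})"
    unfolding cut_pairs_def by (intro card_UN_le) simp
  also have "\<dots> \<le> (\<Sum>j<m. 4)"
  proof (intro sum_mono)
    fix j
    let ?l = "[(m + j, 2 * m + j), (2 * m + j, m + j), ((q - 1) * m + j, j), (j, (q - 1) * m + j)]"
    show "card {(m + j, 2 * m + j), (2 * m + j, m + j), ((q - 1) * m + j, j), (j, (q - 1) * m + j)} \<le> 4"
      using card_length[of ?l] by simp
  qed
  finally show ?thesis by simp
qed

text \<open>Edges cross the cut only from layer 1 or from layer q - 1. For \<open>q \<ge> 4\<close>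
  these differ from layers 0 and q - 2, so every crossing edge is a matching edge.\<close>

lemma cyc_graph_cut_edge:
  assumes q: "4 \<le> q" and m: "0 < m" and E: "(u, v) \<in> cyc_graph q m X Y"
    and cut: "(u < 2 * m) \<noteq> (v < 2 * m)"
  shows "(u, v) \<in> cut_pairs q m \<and> (v, u) \<in> cut_pairs q m"
proof -
  have l: "x < 2 * m \<longleftrightarrow> x div m < 2" for x
    using m by (simp add: div_less_iff_less_mult)
  have uq: "u div m < q"
    using E by (auto simp: cyc_graph_def less_mult_imp_div_less)
  have vl: "v div m = (if u div m = q - 1 then 0 else u div m + 1)"
    using E uq by (auto simp: cyc_graph_def)
  have dec: "x = x div m * m + x mod m" "x mod m < m" for x
    using m by simp_all
  show ?thesis
  proof (cases "u < 2 * m")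
    case True
    then have u1: "u div m = 1" "v div m = 2"
      using cut vl q by (auto simp: l split: if_splits)
    then have "v mod m = u mod m"
      using E q by (auto simp: cyc_graph_def)
    then have "u = m + u mod m" "v = 2 * m + u mod m"
      using u1 dec(1)[of u] dec(1)[of v] by simp_all
    then show ?thesis
      using dec(2)[of u] by (auto simp: cut_pairs_def)
  next
    case False
    then have u1: "u div m = q - 1" "v div m = 0"
      using cut vl q by (auto simp: l split: if_splits)
    then have "v mod m = u mod m"
      using E q by (auto simp: cyc_graph_def)
    then have "u = (q - 1) * m + u mod m" "v = u mod m"
      using u1 dec(1)[of u] dec(1)[of v] by simp_all
    then show ?thesis
      using dec(2)[of u] by (auto simp: cut_pairs_def)
  qed
qed

subsection \<open>Simulation across the cut\<close>

text \<open>Induction on the round, with the same seeds in all three runs. A node has the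
  neighbourhood of its own side's run; messages from that side agree by induction, and those across
  the cut agree because both original runs send the same there.\<close>

lemma states_cut_and_paste:
  assumes own1: "\<And>v. v \<in> W \<Longrightarrow> out_nbrs E v = out_nbrs E1 v \<and> in_nbrs E v = in_nbrs E1 v"
    and own2: "\<And>v. v \<notin> W \<Longrightarrow> out_nbrs E v = out_nbrs E2 v \<and> in_nbrs E v = in_nbrs E2 v"
    and cut: "\<And>u v. u \<in> nbrs E v \<Longrightarrow> (u \<in> W) \<noteq> (v \<in> W) \<Longrightarrow> (u, v) \<in> C"
    and same: "\<And>t u v. t < T \<Longrightarrow> (u, v) \<in> C \<Longrightarrow>
                 send A (states A E1 \<rho> t u) v = send A (states A E2 \<rho> t u) v"
    and t: "t \<le> T"
  shows "states A E \<rho> t v = (if v \<in> W then states A E1 \<rho> t v else states A E2 \<rho> t v)"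
  using t
proof (induction t arbitrary: v)
  case 0
  then show ?case using own1[of v] own2[of v] by simp
next
  case (Suc t)
  let ?E = "if v \<in> W then E1 else E2"
  have nb: "nbrs E v = nbrs ?E v"
    using own1[of v] own2[of v] by (simp add: nbrs_def)
  have msg: "send A (states A E \<rho> t u) v = send A (states A ?E \<rho> t u) v" if "u \<in> nbrs E v" for u
    using Suc.IH[of u] Suc.prems cut[OF that] same[of t u v] by auto
  have "states A E \<rho> (Suc t) v = states A ?E \<rho> (Suc t) v"
    using Suc.IH[of v] Suc.prems msg by (simp add: nb cong: if_cong)
  then show ?case by simp
qed

text \<open>Restriction to \<open>{..<T} \<times> C\<close> fixes the value elsewhere, so that
  transcripts lie in a finite extensional function space and can be counted.\<close>

definition transcript ::
  "('s, 'st) congest_alg \<Rightarrow> nat \<Rightarrow> (nat \<times> nat) set \<Rightarrow> (nat \<Rightarrow> 's) \<Rightarrow> (nat \<times> nat) set \<Rightarrow> nat \<times> nat \<times> nat \<Rightarrow> bool list" where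
  "transcript A T C \<rho> E = (\<lambda>(t, u, v)\<in>{..<T} \<times> C. send A (states A E \<rho> t u) v)"

lemma transcript_eq_iff:
  "transcript A T C \<rho> E = transcript A T C \<rho> E' \<longleftrightarrow>
     (\<forall>t<T. \<forall>(u, v)\<in>C. send A (states A E \<rho> t u) v = send A (states A E' \<rho> t u) v)"
  by (auto simp: transcript_def fun_eq_iff restrict_def split: if_splits)

lemma card_bool_lists_length_le: "card {bs :: bool list. length bs \<le> B} \<le> 2 ^ (B + 1)"
proof -
  have "card {bs :: bool list. length bs \<le> B} = (\<Sum>i\<le>B. 2 ^ i)"
    using card_lists_length_le[of "UNIV :: bool set" B] by simp
  also have "\<dots> \<le> 2 ^ (B + 1)"
    by (induction B) auto
  finally show ?thesis .
qed

lemma finite_bool_lists_length_le: "finite {bs :: bool list. length bs \<le> B}"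
  using finite_lists_length_le[of "UNIV :: bool set" B] by simp

text \<open>With the seeds fixed the algorithm is deterministic. Silence, unlike reporting, is a
  condition on each node separately and therefore survives pasting. The exponent counts transcripts:
  fewer than \<open>2 ^ (B + 1)\<close> messages on each of at most \<open>4 * m\<close> ordered cut
  pairs in each of \<open>T\<close> rounds.\<close>

lemma no_report_corruption:
  fixes A :: "('s, 'st) congest_alg" and n T :: nat and \<rho> :: "nat \<Rightarrow> 's"
  assumes q: "4 \<le> q" and m: "0 < m" and B: "\<And>s w. length (send A s w) \<le> B"
  defines "V \<equiv> {..<m} \<times> {..<m}"
  defines "P \<equiv> \<lambda>X Y. \<not> (\<exists>v<n. report A (states A (cyc_graph q m X Y) \<rho> T v))"
  shows "card V * (3 / 20 * disj_mass V (\<lambda>X Y. of_bool (P X Y))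
            - 3 / 2 * 2 ^ ((B + 1) * (4 * m * T)) * bias_rate powr (card V / 200) * 4 ^ card V)
         \<le> inter_mass V (\<lambda>X Y. of_bool (P X Y))"
proof -
  define C where "C = cut_pairs q m"
  define K where "K = (\<Pi>\<^sub>E _\<in>{..<T} \<times> C. {bs :: bool list. length bs \<le> B})"
  define \<tau> where "\<tau> X Y = transcript A T C \<rho> (cyc_graph q m X Y)" for X Y
  have finC: "finite C" by (simp add: C_def finite_cut_pairs)
  have finK: "finite K"
    unfolding K_def by (intro finite_PiE finite_SigmaI finC finite_bool_lists_length_le) simp
  have "card K = card {bs :: bool list. length bs \<le> B} ^ (T * card C)"
    using finC by (simp add: K_def card_PiE card_cartesian_product)
  also have "\<dots> \<le> (2 ^ (B + 1)) ^ (T * card C)"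
    by (intro power_mono card_bool_lists_length_le) simp
  also have "\<dots> \<le> (2 ^ (B + 1)) ^ (4 * m * T)"
    using card_cut_pairs[of q m] by (intro power_increasing) (simp_all add: C_def)
  finally have cardK: "card K \<le> 2 ^ ((B + 1) * (4 * m * T))"
    by (simp only: power_mult[of 2 "B + 1"])
  have "card V * (3 / 20 * disj_mass V (\<lambda>X Y. of_bool (P X Y))
            - 3 / 2 * card K * bias_rate powr (card V / 200) * 4 ^ card V)
         \<le> inter_mass V (\<lambda>X Y. of_bool (P X Y))"
  proof (rule protocol_corruption[of V K \<tau> P])
    show "finite V" by (simp add: V_def)
    show "finite K" by (fact finK)
    show "\<tau> X Y \<in> K" for X Y
      using B by (auto simp: \<tau>_def transcript_def K_def)
  next
    fix X Y X' Y'
    assume P: "P X Y" "P X' Y'" and eq: "\<tau> X Y = \<tau> X' Y'"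
    let ?E = "cyc_graph q m X Y'" and ?E1 = "cyc_graph q m X Y" and ?E2 = "cyc_graph q m X' Y'"
    let ?W = "{..<2 * m}"
    have same: "send A (states A ?E1 \<rho> t u) v = send A (states A ?E2 \<rho> t u) v"
      if "t < T" "(u, v) \<in> C" for t u v
      using eq that unfolding \<tau>_def transcript_eq_iff by blast
    have st: "states A ?E \<rho> t v = (if v \<in> ?W then states A ?E1 \<rho> t v else states A ?E2 \<rho> t v)"
      if t: "t \<le> T" for t v
    proof (rule states_cut_and_paste[where C = C and T = T])
      show "out_nbrs ?E v = out_nbrs ?E1 v \<and> in_nbrs ?E v = in_nbrs ?E1 v" if "v \<in> ?W" for v
        using that cyc_graph_local_low[OF q, of v m X Y' Y] by simp
      show "out_nbrs ?E v = out_nbrs ?E2 v \<and> in_nbrs ?E v = in_nbrs ?E2 v" if "v \<notin> ?W" for v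
        using that cyc_graph_local_high[OF q m, of v X Y' X'] by simp
      show "(u, v) \<in> C" if "u \<in> nbrs ?E v" "(u \<in> ?W) \<noteq> (v \<in> ?W)" for u v
        using that cyc_graph_cut_edge[OF q m, of u v X Y'] cyc_graph_cut_edge[OF q m, of v u X Y']
        by (auto simp: nbrs_def out_nbrs_def in_nbrs_def C_def)
      show "send A (states A ?E1 \<rho> t u) v = send A (states A ?E2 \<rho> t u) v"
        if "t < T" "(u, v) \<in> C" for t u v
        using that by (rule same)
    qed (rule t)
    \<comment> \<open>Every node ends the hybrid run in its state from one of two silent
      runs.\<close>
    have "\<not> report A (states A ?E \<rho> T v)" if "v < n" for v
      using P that st[of T v] by (simp add: P_def)
    then have "P X Y'" by (simp add: P_def)
    moreover have "\<tau> X Y' = \<tau> X Y"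
    proof -
      have "send A (states A ?E \<rho> t u) v = send A (states A ?E1 \<rho> t u) v"
        if "t < T" "(u, v) \<in> C" for t u v
        using that same[OF that] by (simp add: st)
      then show ?thesis
        unfolding \<tau>_def transcript_eq_iff by blast
    qed
    ultimately show "P X Y' \<and> \<tau> X Y' = \<tau> X Y" ..
  qed
  moreover have "card K * (bias_rate powr (card V / 200) * 4 ^ card V)
      \<le> 2 ^ ((B + 1) * (4 * m * T)) * (bias_rate powr (card V / 200) * 4 ^ card V)"
  proof (rule mult_right_mono)
    show "real (card K) \<le> 2 ^ ((B + 1) * (4 * m * T))"
      using cardK by (metis of_nat_le_iff of_nat_numeral of_nat_power)
  qed simp
  then have "3 / 2 * card K * bias_rate powr (card V / 200) * 4 ^ card V
      \<le> 3 / 2 * 2 ^ ((B + 1) * (4 * m * T)) * bias_rate powr (card V / 200) * 4 ^ card V"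
    unfolding mult.assoc by (rule mult_left_mono) simp
  then have "card V * (3 / 20 * disj_mass V (\<lambda>X Y. of_bool (P X Y))
            - 3 / 2 * 2 ^ ((B + 1) * (4 * m * T)) * bias_rate powr (card V / 200) * 4 ^ card V)
      \<le> card V * (3 / 20 * disj_mass V (\<lambda>X Y. of_bool (P X Y))
            - 3 / 2 * card K * bias_rate powr (card V / 200) * 4 ^ card V)"
    by (intro mult_left_mono diff_left_mono) auto
  ultimately show ?thesis by linarith
qed

section \<open>Averaging over the random seeds\<close>

lemma integrable_of_bool_pmf: "integrable (measure_pmf p) (\<lambda>x. of_bool (P x) :: real)"
  by (rule measure_pmf.integrable_const_bound[where B = 1]) auto

lemma expectation_of_bool: "measure_pmf.expectation p (\<lambda>x. of_bool (P x)) = measure_pmf.prob p {x. P x}"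
proof -
  have "(\<lambda>x. of_bool (P x) :: real) = indicator {x. P x}"
    by (auto simp: indicator_def)
  then show ?thesis by simp
qed

lemma expectation_disj_mass:
  "integrable (measure_pmf p) (\<lambda>\<rho>. disj_mass V (\<lambda>X Y. of_bool (P \<rho> X Y)))"
  "measure_pmf.expectation p (\<lambda>\<rho>. disj_mass V (\<lambda>X Y. of_bool (P \<rho> X Y)))
     = disj_mass V (\<lambda>X Y. measure_pmf.prob p {\<rho>. P \<rho> X Y})"
  unfolding disj_mass_def
  by (simp_all add: integrable_of_bool_pmf expectation_of_bool)

lemma expectation_inter_mass:
  "integrable (measure_pmf p) (\<lambda>\<rho>. inter_mass V (\<lambda>X Y. of_bool (P \<rho> X Y)))"
  "measure_pmf.expectation p (\<lambda>\<rho>. inter_mass V (\<lambda>X Y. of_bool (P \<rho> X Y)))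
     = inter_mass V (\<lambda>X Y. measure_pmf.prob p {\<rho>. P \<rho> X Y})"
  unfolding inter_mass_def
  by (simp_all add: integrable_of_bool_pmf expectation_of_bool)

text \<open>The corruption bound holds for every outcome of the seeds, hence in expectation. Silence
  has probability at least 2 / 3 on disjoint and at most 1 / 3 on intersecting pairs. Division by
  \<open>card V * 4 ^ card V\<close> leaves \<open>1 / 10 - 3 / 2 * \<epsilon> \<le> 1 / 12\<close>,
  that is \<open>\<epsilon> \<ge> 1 / 90\<close>.\<close>

lemma cycle_detection_transcript_bound:
  fixes A :: "('s, 'st) congest_alg"
  assumes q: "4 \<le> q" and m: "0 < m" and n: "q * m \<le> n"
    and A: "solves_cycle_detection q n B T A"
  shows "1 / 90 \<le> 2 ^ ((B + 1) * (4 * m * T)) * bias_rate powr (real m ^ 2 / 200)"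
proof -
  define V where "V = {..<m} \<times> {..<m}"
  define p where "p = Pi_pmf {..<n} undefined (coin A)"
  define P where "P \<rho> X Y \<longleftrightarrow> \<not> (\<exists>v<n. report A (states A (cyc_graph q m X Y) \<rho> T v))" for \<rho> X Y
  define \<epsilon> where "\<epsilon> = 2 ^ ((B + 1) * (4 * m * T)) * bias_rate powr (card V / 200)"
  have fin: "finite V" by (simp add: V_def)
  have cV: "real (card V) = real m ^ 2"
    by (simp add: V_def card_cartesian_product power2_eq_square)
  have ok: "measure_pmf.prob p {\<rho>. \<not> P \<rho> X Y \<longleftrightarrow> X \<inter> Y \<noteq> {}} \<ge> 2 / 3" if "X \<subseteq> V" for X Y
  proof -
    have "digraph n (cyc_graph q m X Y)"
      using q n by (intro digraph_cyc_graph) auto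
    then have "2 / 3 \<le> measure_pmf.prob p {\<rho>. \<not> P \<rho> X Y \<longleftrightarrow> has_dcycle (cyc_graph q m X Y) q}"
      using A by (auto simp: solves_cycle_detection_def p_def P_def)
    moreover have "has_dcycle (cyc_graph q m X Y) q \<longleftrightarrow> X \<inter> Y \<noteq> {}"
      using has_dcycle_cyc_graph_iff[OF q] that by (simp add: V_def)
    ultimately show ?thesis by simp
  qed
  have disj: "2 / 3 \<le> measure_pmf.prob p {\<rho>. P \<rho> X Y}" if "X \<subseteq> V" "X \<inter> Y = {}" for X Y
    using ok[OF that(1), of Y] that(2) by simp
  have inter: "measure_pmf.prob p {\<rho>. P \<rho> X Y} \<le> 1 / 3" if "X \<subseteq> V" "X \<inter> Y \<noteq> {}" for X Y
  proof -
    have "measure_pmf.prob p {\<rho>. P \<rho> X Y} = 1 - measure_pmf.prob p {\<rho>. \<not> P \<rho> X Y}"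
      using measure_pmf.prob_compl[of "{\<rho>. \<not> P \<rho> X Y}" p] by (simp add: Compl_eq_Diff_UNIV[symmetric] Collect_neg_eq[symmetric])
    then show ?thesis
      using ok[OF that(1), of Y] that(2) by simp
  qed
  have pointwise: "card V * (3 / 20 * disj_mass V (\<lambda>X Y. of_bool (P \<rho> X Y)) - 3 / 2 * \<epsilon> * 4 ^ card V)
         \<le> inter_mass V (\<lambda>X Y. of_bool (P \<rho> X Y))" for \<rho>
    using no_report_corruption[OF q m, of A B n \<rho> T] A
    by (simp add: solves_cycle_detection_def V_def P_def \<epsilon>_def mult.assoc)
  have "card V * (3 / 20 * (2 / 3 * 4 ^ card V) - 3 / 2 * \<epsilon> * 4 ^ card V)
      \<le> card V * (3 / 20 * disj_mass V (\<lambda>X Y. measure_pmf.prob p {\<rho>. P \<rho> X Y}) - 3 / 2 * \<epsilon> * 4 ^ card V)"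
    using disj_mass_mono[of V "\<lambda>_ _. 2 / 3" "\<lambda>X Y. measure_pmf.prob p {\<rho>. P \<rho> X Y}"] disj
    by (intro mult_left_mono) (auto simp: disj_mass_const[OF fin])
  also have "\<dots> = measure_pmf.expectation p (\<lambda>\<rho>.
      card V * (3 / 20 * disj_mass V (\<lambda>X Y. of_bool (P \<rho> X Y)) - 3 / 2 * \<epsilon> * 4 ^ card V))"
    by (simp add: expectation_disj_mass)
  also have "\<dots> \<le> measure_pmf.expectation p (\<lambda>\<rho>. inter_mass V (\<lambda>X Y. of_bool (P \<rho> X Y)))"
    by (intro integral_mono pointwise expectation_inter_mass integrable_mult_right
        Bochner_Integration.integrable_diff expectation_disj_mass measure_pmf.integrable_const)
  also have "\<dots> = inter_mass V (\<lambda>X Y. measure_pmf.prob p {\<rho>. P \<rho> X Y})"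
    by (rule expectation_inter_mass)
  also have "\<dots> \<le> inter_mass V (\<lambda>_ _. 1 / 3)"
    by (intro inter_mass_mono inter)
  also have "\<dots> = card V * (4 ^ card V / 12)"
    by (simp add: inter_mass_const[OF fin])
  finally have "3 / 20 * (2 / 3 * 4 ^ card V) - 3 / 2 * \<epsilon> * 4 ^ card V \<le> 4 ^ card V / 12"
    using m by (subst (asm) mult_le_cancel_left_pos) (auto simp: cV)
  then have "(3 / 20 * (2 / 3) - 3 / 2 * \<epsilon>) * 4 ^ card V \<le> (1 / 12) * 4 ^ card V"
    by (simp add: algebra_simps)
  then have "3 / 20 * (2 / 3) - 3 / 2 * \<epsilon> \<le> 1 / 12"
    by (subst (asm) mult_le_cancel_right_pos) auto
  then have "1 / 90 \<le> \<epsilon>" by simp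
  then show ?thesis by (simp add: \<epsilon>_def cV)
qed

section \<open>The asymptotic lower bound\<close>

theorem theorem4:
  fixes q :: nat
  assumes "q \<ge> 4"
  shows "\<forall>C > 0. \<exists>c > 0. \<exists>N. \<forall>n \<ge> N. \<forall>B T (A :: ('s, 'st) congest_alg).
           real B \<le> C * log 2 (real n) \<and> solves_cycle_detection q n B T A
           \<longrightarrow> real T \<ge> c * real n / log 2 (real n)"
proof (intro allI impI)
  fix C :: real
  assume C: "C > 0"
  \<comment> \<open>Chosen so that \<open>bias_rate powr (real m ^ 2 / 200) = exp (- \<kappa> * real
    m ^ 2)\<close>.\<close>
  define \<kappa> where "\<kappa> = - ln bias_rate / 200"
  have \<kappa>: "\<kappa> > 0" using bias_rate by (simp add: \<kappa>_def)
  \<comment> \<open>The 16 collects 4 from the number of cut pairs, 2 from giving up half of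
    \<open>\<kappa> * real m ^ 2\<close>, and 2 from \<open>n \<le> 2 * q * m\<close>.\<close>
  define c where "c = \<kappa> / (16 * ln 2 * q * (C + 1))"
  have c: "c > 0" using \<kappa> C assms by (simp add: c_def)
  \<comment> \<open>Large enough that \<open>ln 90\<close> is at most half of
    \<open>\<kappa> * real m ^ 2\<close> once \<open>m \<ge> m0\<close>; the added 1 ensures
    \<open>m \<ge> 1\<close>.\<close>
  define m0 where "m0 = nat \<lceil>2 * ln 90 / \<kappa>\<rceil> + 1"
  show "\<exists>c > 0. \<exists>N. \<forall>n \<ge> N. \<forall>B T (A :: ('s, 'st) congest_alg).
           real B \<le> C * log 2 (real n) \<and> solves_cycle_detection q n B T A
           \<longrightarrow> real T \<ge> c * real n / log 2 (real n)"
  proof (intro exI[of _ c] conjI c exI[of _ "q * m0"] allI impI)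
    fix n B T and A :: "('s, 'st) congest_alg"
    assume n: "q * m0 \<le> n" and "real B \<le> C * log 2 (real n) \<and> solves_cycle_detection q n B T A"
    then have B: "real B \<le> C * log 2 (real n)" and A: "solves_cycle_detection q n B T A" by auto
    define m where "m = n div q"
    have m: "m \<ge> m0"
      using n assms by (simp add: m_def less_eq_div_iff_mult_less_eq mult.commute)
    have "m0 \<ge> 1" by (simp add: m0_def)
    with m have m1: "m \<ge> 1" by simp
    have qm: "q * m \<le> n" by (simp add: m_def)
    have "n mod q < q" using assms by simp
    then have "n \<le> q * m + q" unfolding m_def by (metis add_left_mono less_imp_le mult_div_mod_eq)
    also have "\<dots> \<le> 2 * q * m" using m1 by simp
    finally have n2: "real n \<le> 2 * q * m" by (metis of_nat_le_iff of_nat_mult of_nat_numeral)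
    have "q * 1 \<le> q * m" using m1 by (intro mult_left_mono) auto
    then have n4: "n \<ge> 4" using assms qm by linarith
    define L where "L = log 2 (real n)"
    have L: "L \<ge> 1" using n4 by (simp add: L_def le_log_iff)
    have "1 / 90 \<le> 2 ^ ((B + 1) * (4 * m * T)) * bias_rate powr (real m ^ 2 / 200)"
      using cycle_detection_transcript_bound[OF assms _ qm A] m1 by simp
    then have "ln (1 / 90) \<le> ln (2 ^ ((B + 1) * (4 * m * T)) * bias_rate powr (real m ^ 2 / 200))"
      by (subst ln_le_cancel_iff) (use bias_rate in auto)
    also have "\<dots> = real ((B + 1) * (4 * m * T)) * ln 2 - \<kappa> * real m ^ 2"
      using bias_rate by (simp add: ln_mult ln_realpow ln_powr \<kappa>_def)
    finally have main: "\<kappa> * real m ^ 2 - ln 90 \<le> real ((B + 1) * (4 * m * T)) * ln 2"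
      by (simp add: ln_div)
    have "2 * ln 90 / \<kappa> \<le> real m0" unfolding m0_def by linarith
    also have "\<dots> \<le> real m * 1" using m by simp
    also have "\<dots> \<le> real m * real m" using m1 by (intro mult_left_mono) auto
    finally have "ln 90 \<le> \<kappa> * real m ^ 2 / 2"
      using \<kappa> by (simp add: field_simps power2_eq_square)
    \<comment> \<open>One factor \<open>m\<close> cancels: the universe has \<open>m ^ 2\<close>
      pairs but the cut only linearly many links, which makes the bound linear in
      \<open>n\<close>.\<close>
    with main have "real m * (\<kappa> * real m / 2) \<le> real m * ((real B + 1) * 4 * T * ln 2)"
      by (simp add: algebra_simps power2_eq_square)
    then have "\<kappa> * real m / 2 \<le> (real B + 1) * 4 * T * ln 2"
      using m1 by (subst (asm) mult_le_cancel_left_pos) auto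
    \<comment> \<open>Since \<open>L \<ge> 1\<close>, the 1 in \<open>B + 1\<close> is absorbed into
      \<open>(C + 1) * L\<close>.\<close>
    also have "\<dots> \<le> ((C + 1) * L) * 4 * T * ln 2"
      using B L by (intro mult_right_mono) (auto simp: L_def algebra_simps)
    finally have k: "\<kappa> * real m \<le> 8 * ln 2 * (C + 1) * L * T"
      by (simp add: algebra_simps)
    have "\<kappa> * real n \<le> \<kappa> * (2 * q * m)"
      using \<kappa> n2 by (intro mult_left_mono) auto
    also have "\<dots> = 2 * q * (\<kappa> * real m)" by simp
    also have "\<dots> \<le> 2 * q * (8 * ln 2 * (C + 1) * L * T)"
      by (intro mult_left_mono k) simp
    finally have "\<kappa> * real n \<le> (16 * ln 2 * q * (C + 1)) * (L * T)"
      by (simp add: algebra_simps)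
    then have "c * real n \<le> L * T"
      using C assms by (simp add: c_def divide_le_eq mult.commute)
    then show "c * real n / log 2 (real n) \<le> real T"
      using L by (simp add: L_def[symmetric] divide_le_eq mult.commute)
  qed
qed

end
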